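(* Let $E,F\subset\mathbb{Z}$ be such that $d^{*}(E)+d^{*}(F)>1$. Then for every prime number $p$ and every $n\in\mathbb{N}$ the arithmetic difference $E-F=\{a-b: a\in E,\ b\in F\}$ contains a multiple of $p^n$.
   Context: An interval of integers is a set $I=(M,N]=\{M+1,\dots,N\}\subset\mathbb{Z}$, with length $|I|=N-M$. The upper Banach density of $E\subset\mathbb{Z}$ is $d^{*}(E)=\limsup_{|I|\to\infty}\frac{|E\cap I|}{|I|}=\lim_{L\to\infty}\sup\{|E\cap I|/|I| : |I|\ge L\}$, where $I$ runs over all intervals of integers. Zero counts as a multiple of $p^n$. *)

theory Defs
  imports Complex_Main "HOL-Computational_Algebra.Primes"
begin

(* For L = 0 the empty interval also occurs, contributing 0 / 0 = 0;
   this does not affect the limit. *)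
definition interval_density_sup :: "int set \<Rightarrow> nat \<Rightarrow> real" where
  "interval_density_sup E L =
     Sup {real (card (E \<inter> {M<..N})) / real (card {M<..N}) | M N :: int. M \<le> N \<and> L \<le> card {M<..N}}"

definition upper_Banach_density :: "int set \<Rightarrow> real" where
  "upper_Banach_density E = lim (interval_density_sup E)"

(* The Sup is of a nonempty bounded set and the limit exists, so neither of the
   above takes an unspecified default value. *)
lemma interval_densities_nonempty:
  "{real (card (E \<inter> {M<..N})) / real (card {M<..N}) | M N :: int. M \<le> N \<and> L \<le> card {M<..N}} \<noteq> {}"
proof -
  have "(0::int) \<le> int L \<and> L \<le> card {0<..int L}" by simp
  then show ?thesis by blast
qed

lemma interval_density_bounds:
  "0 \<le> real (card (E \<inter> {M<..N::int})) / real (card {M<..N})"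
  "real (card (E \<inter> {M<..N::int})) / real (card {M<..N}) \<le> 1"
proof -
  have "card (E \<inter> {M<..N}) \<le> card {M<..N}"
    by (rule card_mono) auto
  then show "real (card (E \<inter> {M<..N::int})) / real (card {M<..N}) \<le> 1"
    by (cases "card {M<..N} = 0") (simp_all only: divide_le_eq_1 of_nat_le_iff of_nat_0_less_iff of_nat_0_eq_iff of_nat_0 div_by_0 zero_le_one, auto)
qed simp

lemma interval_densities_bdd_above:
  "bdd_above {real (card (E \<inter> {M<..N})) / real (card {M<..N}) | M N :: int. M \<le> N \<and> L \<le> card {M<..N}}"
  by (rule bdd_aboveI[of _ 1]) (use interval_density_bounds(2) in blast)

lemma interval_density_sup_LIMSEQ:
  "interval_density_sup E \<longlonglongrightarrow> upper_Banach_density E"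
proof -
  have mono: "decseq (interval_density_sup E)"
    unfolding decseq_def interval_density_sup_def
  proof (intro allI impI)
    fix m n :: nat
    assume "m \<le> n"
    show "Sup {real (card (E \<inter> {M<..N})) / real (card {M<..N}) | M N :: int. M \<le> N \<and> n \<le> card {M<..N}}
        \<le> Sup {real (card (E \<inter> {M<..N})) / real (card {M<..N}) | M N :: int. M \<le> N \<and> m \<le> card {M<..N}}"
      by (rule cSup_subset_mono[OF interval_densities_nonempty interval_densities_bdd_above])
         (use \<open>m \<le> n\<close> le_trans in blast)
  qed
  have "0 \<le> interval_density_sup E L" for L
  proof -
    obtain x where x: "x \<in> {real (card (E \<inter> {M<..N})) / real (card {M<..N}) | M N :: int. M \<le> N \<and> L \<le> card {M<..N}}"
      using interval_densities_nonempty[of E L] by blast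
    then have "0 \<le> x" using interval_density_bounds(1) by blast
    also have "x \<le> interval_density_sup E L"
      unfolding interval_density_sup_def
      by (rule cSup_upper[OF x interval_densities_bdd_above])
    finally show ?thesis .
  qed
  then obtain l where "interval_density_sup E \<longlonglongrightarrow> l"
    using decseq_convergent[OF mono, of 0] by blast
  then show ?thesis
    unfolding upper_Banach_density_def by (metis limI)
qed

end

(* The statement holds for every modulus q > 0 in place of p^n: the density of a set is at most
   the proportion of residue classes mod q that it meets. If no difference a - b were divisible
   by q, then E and F would meet disjoint sets of residue classes, and their densities would
   add up to at most 1. *)
theory Submission
  imports Defs
begin

text \<open>An integer is determined by its residue and its quotient modulo \<open>q\<close>.
  Elements of \<open>E\<close> use only the residues met by \<open>E\<close>, and the quotients of
  points of the interval fill a range of about length / \<open>q\<close> integers.\<close>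

lemma card_Int_interval_le_residues:
  fixes E :: "int set" and q M N :: int
  assumes "q > 0" "M \<le> N"
  shows "real (card (E \<inter> {M<..N})) \<le>
    real (card ((\<lambda>x. x mod q) ` E)) * (real (card {M<..N}) / of_int q + 2)"
proof -
  let ?R = "(\<lambda>x. x mod q) ` E" and ?D = "{M div q..N div q}"
  \<comment> \<open>\<open>E\<close> may be infinite, and \<open>card\<close> is 0 on infinite sets,
    so the bound needs the residue set to be finite.\<close>
  have "finite ?R"
    by (rule finite_subset[of _ "{0..<q}"]) (use assms in auto)
  have mono: "M div q \<le> N div q"
    using assms by (simp add: zdiv_mono1)
  have inj: "inj_on (\<lambda>x. (x mod q, x div q)) (E \<inter> {M<..N})"
    by (rule inj_onI) (metis div_mult_mod_eq prod.inject)
  have "(\<lambda>x. (x mod q, x div q)) ` (E \<inter> {M<..N}) \<subseteq> ?R \<times> ?D"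
    using assms by (auto intro!: zdiv_mono1)
  then have "card (E \<inter> {M<..N}) \<le> card (?R \<times> ?D)"
    using \<open>finite ?R\<close> by (intro card_inj_on_le[OF inj]) auto
  then have "real (card (E \<inter> {M<..N})) \<le> real (card ?R) * real (card ?D)"
    by (metis card_cartesian_product of_nat_le_iff of_nat_mult)
  \<comment> \<open>One unit of the 2 comes from counting both end quotients, the other from
    rounding \<open>M / q\<close> down, which loses less than 1.\<close>
  also have "real (card ?D) \<le> real (card {M<..N}) / of_int q + 2"
  proof -
    have "real_of_int (N div q) \<le> N / q"
      using of_int_floor_le[of "real_of_int N / q"] by (simp add: floor_divide_of_int_eq)
    moreover have "real_of_int M / q < M div q + 1"
      using floor_correct[of "real_of_int M / q"] by (simp add: floor_divide_of_int_eq)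
    ultimately show ?thesis
      using mono assms(2) by (simp add: diff_divide_distrib)
  qed
  finally show ?thesis
    by (simp add: mult_left_mono)
qed

text \<open>After division by the length of the interval, the additive 2 in the counting bound
  contributes an error that vanishes as the length grows.\<close>

lemma upper_Banach_density_le_residues:
  fixes E :: "int set" and q :: int
  assumes "q > 0"
  shows "upper_Banach_density E \<le> real (card ((\<lambda>x. x mod q) ` E)) / of_int q"
proof -
  define r where "r = real (card ((\<lambda>x. x mod q) ` E))"
  have "r \<ge> 0"
    by (simp add: r_def)
  \<comment> \<open>At \<open>L = 0\<close> the error term would be 0 by convention and the bound
    can fail: a singleton \<open>E\<close> has density 1 in an interval of length 1. The limit only
    needs the bound from index 1 on.\<close>
  have bound: "interval_density_sup E L \<le> r / of_int q + 2 * r / real L" if "L > 0" for L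
    unfolding interval_density_sup_def
  proof (rule cSup_least[OF interval_densities_nonempty])
    fix d
    assume "d \<in> {real (card (E \<inter> {M<..N})) / real (card {M<..N}) | M N :: int.
      M \<le> N \<and> L \<le> card {M<..N}}"
    then obtain M N :: int where MN: "M \<le> N" "L \<le> card {M<..N}"
      and d: "d = real (card (E \<inter> {M<..N})) / real (card {M<..N})"
      by blast
    define l where "l = real (card {M<..N})"
    have "real L \<le> l"
      unfolding l_def using MN(2) of_nat_le_iff by blast
    then have "l > 0"
      using that by simp
    have "d \<le> r * (l / of_int q + 2) / l"
      unfolding d l_def[symmetric]
      using card_Int_interval_le_residues[OF assms MN(1), of E] \<open>l > 0\<close>
      by (intro divide_right_mono) (simp_all add: r_def l_def)
    \<comment> \<open>Passing from \<open>l\<close> to \<open>L\<close> makes the bound uniform over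
      all intervals in the supremum.\<close>
    also have "\<dots> = r / of_int q + 2 * r / l"
      using \<open>l > 0\<close> assms by (simp add: field_simps)
    also have "2 * r / l \<le> 2 * r / real L"
      using \<open>real L \<le> l\<close> \<open>r \<ge> 0\<close> that by (intro divide_left_mono) auto
    finally show "d \<le> r / of_int q + 2 * r / real L"
      by simp
  qed
  have "(\<lambda>L. r / of_int q + 2 * r / real L) \<longlonglongrightarrow> r / of_int q + 0"
    by (intro tendsto_intros lim_const_over_n)
  then have "upper_Banach_density E \<le> r / of_int q + 0"
    by (rule LIMSEQ_le[OF interval_density_sup_LIMSEQ])
       (use bound in \<open>auto intro!: exI[of _ 1]\<close>)
  then show ?thesis
    by (simp add: r_def)
qed

lemma ex_difference_dvd:
  fixes E F :: "int set" and q :: int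
  assumes dens: "upper_Banach_density E + upper_Banach_density F > 1" and "q > 0"
  shows "\<exists>a\<in>E. \<exists>b\<in>F. q dvd a - b"
proof (rule ccontr)
  assume "\<not> ?thesis"
  then have disj: "(\<lambda>x. x mod q) ` E \<inter> (\<lambda>x. x mod q) ` F = {}"
    by (auto simp: mod_eq_dvd_iff)
  have sub: "(\<lambda>x. x mod q) ` A \<subseteq> {0..<q}" for A
    using \<open>q > 0\<close> by auto
  then have fin: "finite ((\<lambda>x. x mod q) ` A)" for A
    using finite_subset by blast
  \<comment> \<open>By disjointness the two counts add up to the size of the union, which lies among
    the \<open>q\<close> residues.\<close>
  have "card ((\<lambda>x. x mod q) ` E) + card ((\<lambda>x. x mod q) ` F) \<le> card {0..<q}"
    unfolding card_Un_disjoint[OF fin fin disj, symmetric]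
    by (rule card_mono) (use sub in auto)
  then have "real (card ((\<lambda>x. x mod q) ` E)) + real (card ((\<lambda>x. x mod q) ` F)) \<le> of_int q"
    using \<open>q > 0\<close> by simp
  then have "real (card ((\<lambda>x. x mod q) ` E)) / of_int q
      + real (card ((\<lambda>x. x mod q) ` F)) / of_int q \<le> 1"
    using \<open>q > 0\<close> by (simp flip: add_divide_distrib)
  with dens show False
    using upper_Banach_density_le_residues[OF \<open>q > 0\<close>, of E]
      upper_Banach_density_le_residues[OF \<open>q > 0\<close>, of F] by linarith
qed

theorem corollary1p1:
  fixes E F :: "int set"
  assumes "upper_Banach_density E + upper_Banach_density F > 1"
  shows "\<forall>(p::nat) (n::nat). prime p \<longrightarrow>
           (\<exists>x \<in> {a - b | a b. a \<in> E \<and> b \<in> F}. int p ^ n dvd x)"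
proof (intro allI impI)
  fix p n :: nat
  assume "prime p"
  then have "int p ^ n > 0"
    by (simp add: prime_gt_0_nat)
  from ex_difference_dvd[OF assms this]
  show "\<exists>x \<in> {a - b | a b. a \<in> E \<and> b \<in> F}. int p ^ n dvd x"
    by blast
qed

end
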